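(* Let $a,b$ be coprime positive integers with $a$ odd, and let $c$ be a positive integer. Put $K=c\,2^{c-1}$. Then $$ R_{a,b,c}(\phi) = K^{\frac 12 (a-1)(b-1)}\prod_{k=1}^{\lfloor c/2\rfloor}\ \prod_{i=1}^{\frac{a-1}2}\ \prod_{j=1}^{b-1} P_{\frac{i\pi}{a},\frac{j\pi}{b},\frac{k\pi}{c}}(\phi). $$
   Context: $T_n$ denotes the Chebyshev polynomial of the first kind ($T_n(\cos\theta)=\cos n\theta$), and $Q_c(s,t,\phi)\in\mathbb{Q}[s,t,\phi]$ is the polynomial $$Q_c(s,t,\phi)=\frac{T_c(t+\phi)-T_c(s+\phi)}{t-s}.$$ $R_{a,b,c}$ is the polynomial in $\phi$ $$R_{a,b,c}(\phi)=\prod_{i=1}^{\frac{a-1}2}\prod_{j=1}^{b-1}Q_c\Bigl(\cos\bigl(\tfrac jb+\tfrac ia\bigr)\pi,\ \cos\bigl(\tfrac jb-\tfrac ia\bigr)\pi,\ \phi\Bigr).$$ For $\gamma\in(0,\frac\pi2)$, $$P_{\alpha,\beta,\gamma}(\phi)=\phi^2+2\phi\cos\alpha\cos\beta+\frac{(\cos^2\alpha-\cos^2\gamma)(\cos^2\beta-\cos^2\gamma)}{\sin^2\gamma},$$ and $P_{\alpha,\beta,\frac\pi2}(\phi)=\phi+\cos\alpha\cos\beta$. Empty products equal $1$. *)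

theory Defs
  imports Complex_Main "HOL-Computational_Algebra.Polynomial"
begin

text \<open>The recurrence makes sense over every commutative ring, and there agrees with the image of
  the integer polynomial. Over the reals it is the polynomial determined by
  \<open>T\<^sub>n (cos \<theta>) = cos (n \<theta>)\<close>; see \<open>chebyshev_T_cos\<close> and \<open>chebyshev_T_unique\<close>.\<close>

fun chebyshev_T :: "nat \<Rightarrow> 'a::comm_ring_1 poly" where
  "chebyshev_T 0 = 1"
| "chebyshev_T (Suc 0) = [:0, 1:]"
| "chebyshev_T (Suc (Suc n)) = [:0, 2:] * chebyshev_T (Suc n) - chebyshev_T n"

lemma chebyshev_T_cos: "poly (chebyshev_T n) (cos \<theta>) = cos (real n * \<theta>)"
proof (induction n rule: chebyshev_T.induct)
  case (3 n)
  have "cos ((real n + 1) * \<theta> + \<theta>) + cos ((real n + 1) * \<theta> - \<theta>) =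
      2 * cos ((real n + 1) * \<theta>) * cos \<theta>"
    by (simp add: cos_add cos_diff)
  then show ?case using 3 by (simp add: algebra_simps)
qed auto

lemma chebyshev_T_unique:
  fixes p :: "real poly"
  assumes "\<And>\<theta>. poly p (cos \<theta>) = cos (real n * \<theta>)"
  shows "p = chebyshev_T n"
proof (rule ccontr)
  assume "p \<noteq> chebyshev_T n"
  then have "finite {x. poly (p - chebyshev_T n) x = 0}"
    by (intro poly_roots_finite) simp
  moreover have "{-1..1} \<subseteq> {x. poly (p - chebyshev_T n) x = 0}"
  proof
    fix x :: real assume "x \<in> {-1..1}"
    then have "x = cos (arccos x)" by simp
    then show "x \<in> {x. poly (p - chebyshev_T n) x = 0}"
      using assms[of "arccos x"] chebyshev_T_cos[of n "arccos x"] by simp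
  qed
  ultimately have "finite {-1..1::real}" by (rule finite_subset[rotated])
  then show False by (simp add: infinite_Icc)
qed

text \<open>The ring of rational polynomials in \<open>s\<close>, \<open>t\<close>, \<open>\<phi>\<close> is rendered as \<open>rat poly poly poly\<close>:
  the outermost indeterminate is \<open>s\<close>, the middle one is \<open>t\<close> and the innermost one is \<open>\<phi>\<close>.\<close>

abbreviation var_s :: "rat poly poly poly" where "var_s \<equiv> [:0, 1:]"
abbreviation var_t :: "rat poly poly poly" where "var_t \<equiv> [:[:0, 1:]:]"
abbreviation var_phi :: "rat poly poly poly" where "var_phi \<equiv> [:[:[:0, 1:]:]:]"

text \<open>The division is the one of polynomials, and it is exact (\<open>Qpoly_exact\<close>).\<close>

definition Qpoly :: "nat \<Rightarrow> rat poly poly poly" where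
  "Qpoly c = (poly (chebyshev_T c) (var_t + var_phi) - poly (chebyshev_T c) (var_s + var_phi))
     div (var_t - var_s)"

lemma diff_dvd_poly_diff:
  fixes x y :: "'a::comm_ring_1"
  shows "(x - y) dvd (poly p x - poly p y)"
proof (induction p)
  case (pCons a p)
  have "poly (pCons a p) x - poly (pCons a p) y =
      (x - y) * poly p x + y * (poly p x - poly p y)"
    by (simp add: algebra_simps)
  then show ?case using pCons.IH by (metis dvd_add dvd_mult dvd_triv_left)
qed simp

lemma Qpoly_exact:
  "(var_t - var_s) * Qpoly c =
     poly (chebyshev_T c) (var_t + var_phi) - poly (chebyshev_T c) (var_s + var_phi)"
  unfolding Qpoly_def
  using diff_dvd_poly_diff[of "var_t + var_phi" "var_s + var_phi" "chebyshev_T c"]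
  by (intro dvd_mult_div_cancel) simp

text \<open>Substitution of real numbers for \<open>s\<close> and \<open>t\<close>; the result is a polynomial in \<open>\<phi>\<close>.\<close>

definition Qsubst :: "nat \<Rightarrow> real \<Rightarrow> real \<Rightarrow> real poly" where
  "Qsubst c s t = poly (poly (map_poly (map_poly (map_poly of_rat)) (Qpoly c)) [:[:s:]:]) [:t:]"

definition Rpoly :: "nat \<Rightarrow> nat \<Rightarrow> nat \<Rightarrow> real poly" where
  "Rpoly a b c =
     (\<Prod>i = 1..(a - 1) div 2. \<Prod>j = 1..b - 1.
        Qsubst c (cos ((real j / real b + real i / real a) * pi))
                 (cos ((real j / real b - real i / real a) * pi)))"

definition Ppoly :: "real \<Rightarrow> real \<Rightarrow> real \<Rightarrow> real poly" where
  "Ppoly \<alpha> \<beta> \<gamma> =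
     (if \<gamma> = pi / 2 then [:cos \<alpha> * cos \<beta>, 1:]
      else [:((cos \<alpha>)\<^sup>2 - (cos \<gamma>)\<^sup>2) * ((cos \<beta>)\<^sup>2 - (cos \<gamma>)\<^sup>2) / (sin \<gamma>)\<^sup>2,
             2 * cos \<alpha> * cos \<beta>, 1:])"

text \<open>The substitution is a ring homomorphism, so its value is the expected difference quotient.\<close>

definition ring_hom_like :: "('a::comm_ring_1 \<Rightarrow> 'b::comm_ring_1) \<Rightarrow> bool" where
  "ring_hom_like h \<longleftrightarrow> h 0 = 0 \<and> h 1 = 1 \<and> (\<forall>x y. h (x + y) = h x + h y) \<and>
     (\<forall>x y. h (x * y) = h x * h y)"

lemma ring_hom_like_diff: "ring_hom_like h \<Longrightarrow> h (x - y) = h x - h y"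
  unfolding ring_hom_like_def by (metis add_diff_cancel diff_add_cancel)

lemma ring_hom_like_sum: "ring_hom_like h \<Longrightarrow> h (sum f A) = (\<Sum>x\<in>A. h (f x))"
  by (induction A rule: infinite_finite_induct) (auto simp: ring_hom_like_def)

lemma ring_hom_like_map_poly:
  assumes "ring_hom_like h"
  shows "ring_hom_like (map_poly h)"
proof -
  have "map_poly h (p * q) = map_poly h p * map_poly h q" for p q
    using assms
    by (intro poly_eqI)
       (simp add: coeff_map_poly coeff_mult ring_hom_like_sum ring_hom_like_def)
  moreover have "map_poly h (p + q) = map_poly h p + map_poly h q" for p q
    using assms by (intro poly_eqI) (simp add: coeff_map_poly ring_hom_like_def)
  ultimately show ?thesis using assms by (auto simp: ring_hom_like_def map_poly_1)
qed

lemma ring_hom_like_chebyshev_T: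
  assumes "ring_hom_like h"
  shows "h (poly (chebyshev_T n) x) = poly (chebyshev_T n) (h x)"
proof (induction n rule: chebyshev_T.induct)
  case (3 n)
  have "h 2 = 2" using assms unfolding ring_hom_like_def by (metis one_add_one)
  with 3 assms show ?case by (simp add: ring_hom_like_diff) (simp add: ring_hom_like_def)
qed (use assms in \<open>auto simp: ring_hom_like_def\<close>)

lemma Qsubst_exact:
  "(t - s) * poly (Qsubst c s t) x = poly (chebyshev_T c) (t + x) - poly (chebyshev_T c) (s + x)"
proof -
  define h :: "rat poly poly poly \<Rightarrow> real" where
    "h p = poly (poly (poly (map_poly (map_poly (map_poly of_rat)) p) [:[:s:]:]) [:t:]) x" for p
  have "ring_hom_like (of_rat :: rat \<Rightarrow> real)"
    by (simp add: ring_hom_like_def of_rat_add of_rat_mult)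
  then have "ring_hom_like (map_poly (map_poly (map_poly (of_rat :: rat \<Rightarrow> real))))"
    by (intro ring_hom_like_map_poly)
  then have hom: "ring_hom_like h"
    by (simp add: ring_hom_like_def h_def)
  have vars: "h var_s = s" "h var_t = t" "h var_phi = x"
    by (simp_all add: h_def map_poly_pCons)
  have add: "h (p + q) = h p + h q" and mult: "h (p * q) = h p * h q" for p q
    using hom by (auto simp: ring_hom_like_def)
  have "h ((var_t - var_s) * Qpoly c) = (t - s) * h (Qpoly c)"
    by (simp only: mult ring_hom_like_diff[OF hom] vars)
  moreover have "h ((var_t - var_s) * Qpoly c) =
      poly (chebyshev_T c) (t + x) - poly (chebyshev_T c) (s + x)"
    by (simp only: Qpoly_exact ring_hom_like_diff[OF hom] ring_hom_like_chebyshev_T[OF hom] add vars)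
  ultimately show ?thesis by (simp add: h_def Qsubst_def)
qed

end

theory Submission
  imports Defs
begin

text \<open>The identity holds factor by factor in \<open>i\<close> and \<open>j\<close>. Writing \<open>t + \<phi> = cos u\<close> and
  \<open>s + \<phi> = cos v\<close>, the numerator of \<open>Q\<^sub>c\<close> is
  \<open>cos (c u) - cos (c v) = 2\<^bsup>c-1\<^esup> \<Prod>\<^bsub>k<c\<^esub> (cos u - cos (v + 2\<pi>k/c))\<close>. The factor \<open>k = 0\<close>
  cancels the denominator \<open>t - s\<close>; the factors \<open>k\<close> and \<open>c - k\<close> multiply to a constant times
  \<open>P\<close> at \<open>\<gamma> = k\<pi>/c\<close>, and the constants combine to \<open>\<Prod>\<^bsub>0<k<c\<^esub> 2 sin (k\<pi>/c) = c\<close>.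
  Such \<open>u\<close> and \<open>v\<close> exist for infinitely many \<open>\<phi>\<close> because \<open>t - s = 2 sin \<alpha> sin \<beta> < 2\<close>; this
  is where \<open>\<alpha> < \<pi>/2\<close> enters.\<close>

section \<open>Roots of unity and the factorisation of a difference of cosines\<close>

text \<open>Both sides are monic of degree \<open>n\<close> and vanish at all \<open>n\<close>-th
  roots of unity; as the leading terms agree, \<open>n\<close> common values suffice.\<close>

lemma monom_minus_one_eq_prod:
  assumes "n > 0"
  shows "monom 1 n - 1 = (\<Prod>k<n. [:- cis (2 * pi * real k / real n), 1:])"
proof -
  let ?\<zeta> = "\<lambda>k. cis (2 * pi * real k / real n)"
  let ?q = "\<Prod>k<n. [:- ?\<zeta> k, 1:]"
  have degree: "degree ?q = n"
    by (subst degree_prod_eq_sum_degree) auto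
  have "lead_coeff ?q = 1"
    by (simp add: lead_coeff_prod)
  then have "coeff ?q n = 1"
    by (simp only: degree)
  with assms degree show ?thesis
  proof (intro poly_eqI_degree_lead_coeff[where n = n and A = "{z. z ^ n = 1}"])
    show "degree (monom 1 n - 1 :: complex poly) \<le> n"
      by (intro degree_diff_le degree_monom_le) simp
    show "poly (monom 1 n - 1) z = poly ?q z" if "z \<in> {z. z ^ n = 1}" for z
    proof -
      have "z \<in> ?\<zeta> ` {..<n}"
        using that bij_betw_imp_surj_on[OF bij_betw_roots_unity[OF assms]] by (simp only:)
      then obtain k where "k < n" "z = ?\<zeta> k" by auto
      then have "poly ?q z = 0"
        by (auto simp: poly_prod)
      with that show ?thesis by (simp add: poly_monom)
    qed
  qed (auto simp: card_roots_unity_eq)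
qed

lemma cis_power_diff_eq_prod:
  assumes "n > 0"
  shows "z ^ n - cis v ^ n = (\<Prod>k<n. z - cis (v + 2 * pi * real k / real n))"
proof -
  have "(\<Prod>k<n. z - cis (v + 2 * pi * real k / real n)) =
      (\<Prod>k<n. cis v * (z / cis v - cis (2 * pi * real k / real n)))"
    by (simp add: cis_mult[symmetric] right_diff_distrib)
  also have "\<dots> = cis v ^ n * poly (monom 1 n - 1) (z / cis v)"
    using assms by (simp add: prod.distrib monom_minus_one_eq_prod poly_prod)
  also have "\<dots> = z ^ n - cis v ^ n"
    by (simp add: poly_monom power_divide right_diff_distrib)
  finally show ?thesis ..
qed

text \<open>The second factor is \<open>cis u - cis (- y)\<close>, written as a conjugate so that
  both factors subtract the same \<open>cis y\<close> and \<open>cis_power_diff_eq_prod\<close>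
  applies to each.\<close>

lemma cos_diff_eq_cis:
  "2 * cis u * complex_of_real (cos u - cos y) = (cis u - cis y) * cnj (cis (- u) - cis y)"
proof -
  have "cis u + cis (- u) = 2 * complex_of_real (cos u)" "cis y + cis (- y) = 2 * complex_of_real (cos y)"
    by (simp_all add: complex_eq_iff)
  then have *: "2 * complex_of_real (cos u - cos y) = cis u + cis (- u) - (cis y + cis (- y))"
    by simp
  have "2 * cis u * complex_of_real (cos u - cos y) =
      cis u * (2 * complex_of_real (cos u - cos y))"
    by (simp only: ac_simps)
  also have "\<dots> = (cis u - cis y) * (cis u - cis (- y))"
    unfolding * by (simp add: algebra_simps cis_mult)
  finally show ?thesis by (simp add: cis_cnj)
qed

lemma cos_multiple_diff_eq_prod:
  assumes "n > 0"
  shows "cos (real n * u) - cos (real n * v) =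
    2 ^ (n - 1) * (\<Prod>k<n. cos u - cos (v + 2 * pi * real k / real n))"
proof -
  let ?y = "\<lambda>k. v + 2 * pi * real k / real n"
  let ?P = "\<Prod>k<n. cos u - cos (?y k)"
  have "2 ^ n * cis u ^ n * complex_of_real ?P =
      (\<Prod>k<n. 2 * cis u * complex_of_real (cos u - cos (?y k)))"
    by (simp add: prod.distrib power_mult_distrib)
  also have "\<dots> = (\<Prod>k<n. cis u - cis (?y k)) * cnj (\<Prod>k<n. cis (- u) - cis (?y k))"
    by (simp only: cos_diff_eq_cis prod.distrib cnj_prod)
  also have "\<dots> = (cis u ^ n - cis v ^ n) * cnj (cis (- u) ^ n - cis v ^ n)"
    by (simp only: cis_power_diff_eq_prod[OF assms])
  \<comment> \<open>The same identity, read backwards at the angles \<open>n * u\<close> and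
    \<open>n * v\<close>.\<close>
  also have "\<dots> = 2 * cis (n * u) * complex_of_real (cos (n * u) - cos (n * v))"
    by (simp only: cos_diff_eq_cis DeMoivre mult_minus_right)
  also have "\<dots> = cis u ^ n * complex_of_real (2 * (cos (n * u) - cos (n * v)))"
    by (simp add: DeMoivre)
  finally have "cis u ^ n * complex_of_real (2 ^ n * ?P) =
      cis u ^ n * complex_of_real (2 * (cos (n * u) - cos (n * v)))"
    by (simp add: ac_simps)
  then have "2 ^ n * ?P = 2 * (cos (n * u) - cos (n * v))"
    by (simp only: mult_cancel_left of_real_eq_iff) simp
  moreover have "(2::real) ^ n = 2 * 2 ^ (n - 1)"
    using assms by (simp flip: power_Suc)
  ultimately show ?thesis by simp
qed

section \<open>The product of the sines\<close>

lemma lessThan_eq_insert_0: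
  assumes "n > 0"
  shows "{..<n} = insert 0 {1..n - 1 :: nat}"
  using assms by force

lemma norm_one_minus_cis_double: "cmod (1 - cis (2 * x)) = 2 * \<bar>sin x\<bar>"
proof -
  have "1 - cis (2 * x) = - 2 * \<i> * complex_of_real (sin x) * cis x"
    by (simp add: complex_eq_iff sin_double cos_double_sin power2_eq_square)
  then show ?thesis by (simp add: norm_mult)
qed

text \<open>Removing the root 1 from \<open>X ^ n - 1\<close> leaves
  \<open>1 + X + ... + X ^ (n - 1)\<close>, with value \<open>n\<close> at 1; the sines are half the
  distances from 1 to the other roots.\<close>

lemma prod_2_sin_eq:
  assumes "n > 0"
  shows "(\<Prod>k = 1..n - 1. 2 * sin (real k * pi / real n)) = real n"
proof -
  let ?\<zeta> = "\<lambda>k. cis (2 * pi * real k / real n)"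
  have "[:-1, 1:] * (\<Prod>k = 1..n - 1. [:- ?\<zeta> k, 1:]) = monom 1 n - 1"
    unfolding monom_minus_one_eq_prod[OF assms] lessThan_eq_insert_0[OF assms]
    by (subst prod.insert) (simp_all del: mult_pCons_left)
  also have "\<dots> = [:0, 1:] ^ n - 1"
    by (simp add: monom_altdef)
  also have "\<dots> = ([:0, 1:] - 1) * (\<Sum>i<n. [:0, 1:] ^ i)"
    by (rule power_diff_1_eq)
  also have "[:0, 1:] - 1 = [:-1, 1::complex:]"
    by (simp add: one_pCons)
  finally have "(\<Prod>k = 1..n - 1. [:- ?\<zeta> k, 1:]) = (\<Sum>i<n. [:0, 1:] ^ i)"
    by (simp only: mult_cancel_left) simp
  then have "poly (\<Prod>k = 1..n - 1. [:- ?\<zeta> k, 1:]) 1 = poly (\<Sum>i<n. [:0, 1:] ^ i) 1"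
    by (rule arg_cong)
  then have "(\<Prod>k = 1..n - 1. 1 - ?\<zeta> k) = of_nat n"
    by (simp add: poly_prod poly_sum poly_power)
  then have "(\<Prod>k = 1..n - 1. cmod (1 - ?\<zeta> k)) = real n"
    by (simp only: prod_norm norm_of_nat)
  moreover have "cmod (1 - ?\<zeta> k) = 2 * sin (real k * pi / real n)" if "k \<in> {1..n - 1}" for k
  proof -
    let ?x = "real k * pi / real n"
    have "0 \<le> ?x" by simp
    moreover have "?x \<le> pi"
    proof -
      have "real k * pi \<le> real n * pi" using that by (intro mult_right_mono) auto
      then show ?thesis using assms by (simp add: field_simps)
    qed
    ultimately have "0 \<le> sin ?x" by (rule sin_ge_zero)
    have "?\<zeta> k = cis (2 * ?x)" by (simp add: ac_simps)
    with \<open>0 \<le> sin ?x\<close> show ?thesis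
      by (simp only: norm_one_minus_cis_double abs_of_nonneg)
  qed
  ultimately show ?thesis by (metis (no_types, lifting) prod.cong)
qed

section \<open>Pairing the factors \<open>k\<close> and \<open>n - k\<close>\<close>

text \<open>Reflection exchanges the indices below and above \<open>n / 2\<close>; only a middle
  index, present for even \<open>n\<close>, is its own partner.\<close>

lemma prod_pair_reflect:
  fixes f :: "nat \<Rightarrow> 'a::comm_monoid_mult"
  assumes "n > 0"
  shows "(\<Prod>k = 1..n - 1. f k) =
    (\<Prod>k = 1..n div 2. if 2 * k = n then f k else f k * f (n - k))"
proof -
  let ?A = "{k \<in> {1..n - 1}. 2 * k < n}"
  let ?M = "{k \<in> {1..n - 1}. 2 * k = n}"
  let ?B = "{k \<in> {1..n - 1}. n < 2 * k}"
  have "(\<Prod>k = 1..n - 1. f k) = prod f ((?A \<union> ?M) \<union> ?B)"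
    by (rule prod.cong) auto
  also have "\<dots> = prod f ?A * prod f ?M * prod f ?B"
    by (subst prod.union_disjoint, auto)+
  also have "prod f ?B = (\<Prod>k\<in>?A. f (n - k))"
    by (rule prod.reindex_bij_witness[where i = "\<lambda>k. n - k" and j = "\<lambda>k. n - k"]) auto
  also have "prod f ?A * prod f ?M * (\<Prod>k\<in>?A. f (n - k)) =
      (\<Prod>k\<in>?A. f k * f (n - k)) * prod f ?M"
    by (simp add: prod.distrib ac_simps)
  also have "\<dots> = (\<Prod>k\<in>?A \<union> ?M. if 2 * k = n then f k else f k * f (n - k))"
    by (subst prod.union_disjoint) (auto intro!: arg_cong2[where f = times] prod.cong)
  also have "?A \<union> ?M = {1..n div 2}"
    using assms by auto
  finally show ?thesis .
qed

text \<open>In terms of \<open>X = cos u\<close> and \<open>Y = cos v\<close> the left-hand side is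
  \<open>X\<^sup>2 - 2 X Y cos 2\<gamma> + Y\<^sup>2 - sin\<^sup>2 2\<gamma>\<close>, whose quadratic part is
  \<open>(X + Y)\<^sup>2 sin\<^sup>2 \<gamma> + (X - Y)\<^sup>2 cos\<^sup>2 \<gamma>\<close>, where
  \<open>X - Y = 2 sin \<alpha> sin \<beta>\<close> and \<open>X + Y = 2 (\<phi> + cos \<alpha> cos \<beta>)\<close>.\<close>

lemma cos_diff_pair_eq_Ppoly:
  assumes v: "cos v = cos (\<beta> + \<alpha>) + \<phi>" and u: "cos u = cos (\<beta> - \<alpha>) + \<phi>"
    and "sin \<gamma> \<noteq> 0" "\<gamma> \<noteq> pi / 2"
  shows "(cos u - cos (v + 2 * \<gamma>)) * (cos u - cos (v - 2 * \<gamma>)) =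
    4 * (sin \<gamma>)\<^sup>2 * poly (Ppoly \<alpha> \<beta> \<gamma>) \<phi>"
proof -
  let ?X = "cos u" and ?Y = "cos v"
  define G where "G = (cos \<gamma>)\<^sup>2"
  have S: "(sin \<gamma>)\<^sup>2 = 1 - G" by (simp add: G_def sin_squared_eq)
  have sv: "(sin v)\<^sup>2 = 1 - ?Y\<^sup>2" by (simp add: sin_squared_eq)
  have s2: "(sin (2 * \<gamma>))\<^sup>2 = 4 * (1 - G) * G"
    by (simp add: sin_double power_mult_distrib S G_def)
  have c2: "cos (2 * \<gamma>) = 2 * G - 1" by (simp add: cos_double_cos G_def)
  have cc: "(cos (2 * \<gamma>))\<^sup>2 = 1 - (sin (2 * \<gamma>))\<^sup>2" by (simp add: cos_squared_eq)
  have "(?X - cos (v + 2 * \<gamma>)) * (?X - cos (v - 2 * \<gamma>)) =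
      ?X\<^sup>2 - 2 * ?X * ?Y * cos (2 * \<gamma>) + ?Y\<^sup>2 * (cos (2 * \<gamma>))\<^sup>2 - (sin v)\<^sup>2 * (sin (2 * \<gamma>))\<^sup>2"
    by (simp add: cos_add cos_diff algebra_simps power2_eq_square)
  also have "\<dots> = (1 - G) * (?X + ?Y)\<^sup>2 + G * (?X - ?Y)\<^sup>2 - 4 * (1 - G) * G"
    unfolding sv cc unfolding s2 c2 by (simp add: algebra_simps power2_eq_square)
  also have "?X + ?Y = 2 * (\<phi> + cos \<alpha> * cos \<beta>)"
    unfolding u v by (simp add: cos_add cos_diff algebra_simps)
  also have "?X - ?Y = 2 * (sin \<alpha> * sin \<beta>)"
    unfolding u v by (simp add: cos_add cos_diff algebra_simps)
  also have "(2 * (sin \<alpha> * sin \<beta>))\<^sup>2 = 4 * ((1 - (cos \<alpha>)\<^sup>2) * (1 - (cos \<beta>)\<^sup>2))"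
    by (simp add: power_mult_distrib sin_squared_eq)
  \<comment> \<open>With A, B the squared cosines of \<alpha>, \<beta>, the constant term rests on
    \<open>(1 - G) * A * B + G * (1 - A) * (1 - B) - (1 - G) * G = (A - G) * (B -
    G)\<close>.\<close>
  also have "(1 - G) * (2 * (\<phi> + cos \<alpha> * cos \<beta>))\<^sup>2 +
        G * (4 * ((1 - (cos \<alpha>)\<^sup>2) * (1 - (cos \<beta>)\<^sup>2))) - 4 * (1 - G) * G =
      4 * ((1 - G) * (\<phi>\<^sup>2 + 2 * cos \<alpha> * cos \<beta> * \<phi>) + ((cos \<alpha>)\<^sup>2 - G) * ((cos \<beta>)\<^sup>2 - G))"
    by (simp add: algebra_simps power2_eq_square)
  also have "\<dots> = 4 * (sin \<gamma>)\<^sup>2 * poly (Ppoly \<alpha> \<beta> \<gamma>) \<phi>"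
  proof -
    have "1 - G \<noteq> 0" using assms(3) S by auto
    then show ?thesis
      using assms(4) by (simp add: Ppoly_def S flip: G_def) (simp add: field_simps power2_eq_square)
  qed
  finally show ?thesis .
qed

lemma cos_multiple_diff_eq_prod_Ppoly:
  assumes "n > 0"
    and v: "cos v = cos (\<beta> + \<alpha>) + \<phi>" and u: "cos u = cos (\<beta> - \<alpha>) + \<phi>"
  shows "cos (real n * u) - cos (real n * v) =
    (cos u - cos v) * (real n * 2 ^ (n - 1) *
      (\<Prod>k = 1..n div 2. poly (Ppoly \<alpha> \<beta> (real k * pi / real n)) \<phi>))"
proof -
  let ?\<gamma> = "\<lambda>k. real k * pi / real n"
  let ?f = "\<lambda>k. cos u - cos (v + 2 * pi * real k / real n)"
  let ?h = "\<lambda>k. 2 * sin (?\<gamma> k)"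
  let ?p = "\<lambda>k. poly (Ppoly \<alpha> \<beta> (?\<gamma> k)) \<phi>"
  have pair: "(if 2 * k = n then ?f k else ?f k * ?f (n - k)) =
      (if 2 * k = n then ?h k else ?h k * ?h (n - k)) * ?p k"
    if k: "k \<in> {1..n div 2}" for k
  proof (cases "2 * k = n")
    case True
    then have n: "real n = 2 * real k" by simp
    have "k > 0" using k by simp
    then have *: "?\<gamma> k = pi / 2" "2 * pi * real k / real n = pi"
      unfolding n by simp_all
    \<comment> \<open>The self-paired factor is linear in \<phi>, which is why \<open>Ppoly\<close>
      has degree 1 at \<open>pi / 2\<close>; here \<open>?h k = 2\<close>.\<close>
    have "?f k = cos u + cos v" unfolding * by simp
    also have "\<dots> = ?h k * ?p k"
      unfolding * u v by (simp add: Ppoly_def cos_add cos_diff algebra_simps)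
    finally show ?thesis using True by simp
  next
    case False
    with k have less: "2 * k < n" "0 < k" by auto
    then have nk: "real (n - k) = real n - real k" by simp
    have reflect: "?\<gamma> (n - k) = pi - ?\<gamma> k"
      using assms(1) unfolding nk by (simp add: field_simps)
    have "?\<gamma> k < pi / 2"
    proof -
      have "real k * 2 < real n" using less by linarith
      then show ?thesis using assms(1) by (simp add: field_simps)
    qed
    moreover have "0 < ?\<gamma> k" using less by simp
    ultimately have \<gamma>: "sin (?\<gamma> k) \<noteq> 0" "?\<gamma> k \<noteq> pi / 2"
      using sin_gt_zero2[of "?\<gamma> k"] by auto
    \<comment> \<open>Up to a full period, the partner index shifts \<open>v\<close> by the opposite
      angle.\<close>
    have "v + 2 * pi * real (n - k) / real n = v - 2 * ?\<gamma> k + 2 * pi"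
      using assms(1) unfolding nk by (simp add: field_simps)
    then have "cos (v + 2 * pi * real (n - k) / real n) = cos (v - 2 * ?\<gamma> k)"
      by (simp only: cos_periodic)
    moreover have "v + 2 * pi * real k / real n = v + 2 * ?\<gamma> k" by simp
    ultimately have "?f k * ?f (n - k) =
        (cos u - cos (v + 2 * ?\<gamma> k)) * (cos u - cos (v - 2 * ?\<gamma> k))"
      by (simp only:)
    also have "\<dots> = 4 * (sin (?\<gamma> k))\<^sup>2 * ?p k"
      using v u \<gamma> by (rule cos_diff_pair_eq_Ppoly)
    \<comment> \<open>Splitting the constant over the pair lets the pairing be undone for the sines,
      giving the full product \<open>n\<close>.\<close>
    also have "4 * (sin (?\<gamma> k))\<^sup>2 = ?h k * ?h (n - k)"
      unfolding reflect by (simp add: power2_eq_square)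
    finally show ?thesis using False by simp
  qed
  have "(\<Prod>k<n. ?f k) = (cos u - cos v) * (\<Prod>k = 1..n - 1. ?f k)"
    unfolding lessThan_eq_insert_0[OF assms(1)] by (subst prod.insert) simp_all
  also have "(\<Prod>k = 1..n - 1. ?f k) =
      (\<Prod>k = 1..n div 2. if 2 * k = n then ?f k else ?f k * ?f (n - k))"
    using assms(1) by (rule prod_pair_reflect)
  also have "\<dots> = (\<Prod>k = 1..n div 2. (if 2 * k = n then ?h k else ?h k * ?h (n - k)) * ?p k)"
    using pair by (rule prod.cong[OF refl])
  also have "\<dots> = (\<Prod>k = 1..n - 1. ?h k) * (\<Prod>k = 1..n div 2. ?p k)"
    by (simp only: prod.distrib[symmetric] prod_pair_reflect[OF assms(1), where f = ?h])
  also have "(\<Prod>k = 1..n - 1. ?h k) = real n"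
    using assms(1) by (rule prod_2_sin_eq)
  finally show ?thesis
    unfolding cos_multiple_diff_eq_prod[OF assms(1)] by (simp only: ac_simps)
qed

section \<open>From cosine values to an identity of polynomials in \<phi>\<close>

lemma Qsubst_eq_prod_Ppoly:
  assumes "n > 0" and \<alpha>: "0 < \<alpha>" "\<alpha> < pi / 2" and \<beta>: "0 < \<beta>" "\<beta> < pi"
  shows "Qsubst n (cos (\<beta> + \<alpha>)) (cos (\<beta> - \<alpha>)) =
    smult (real n * 2 ^ (n - 1)) (\<Prod>k = 1..n div 2. Ppoly \<alpha> \<beta> (real k * pi / real n))"
    (is "?L = ?R")
proof (rule ccontr)
  let ?s = "cos (\<beta> + \<alpha>)" and ?t = "cos (\<beta> - \<alpha>)"
  assume "?L \<noteq> ?R"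
  then have "finite {\<phi>. poly (?L - ?R) \<phi> = 0}"
    by (intro poly_roots_finite) simp
  have pos: "0 < sin \<alpha> * sin \<beta>"
    using \<alpha> \<beta> by (intro mult_pos_pos sin_gt_zero) auto
  have diff: "?t - ?s = 2 * (sin \<alpha> * sin \<beta>)"
    by (simp add: cos_add cos_diff)
  with pos have neq: "?t - ?s \<noteq> 0" by linarith
  text \<open>The interval of those \<open>\<phi>\<close> for which both \<open>s + \<phi>\<close> and \<open>t + \<phi>\<close> are cosines.\<close>
  have "{- 1 - ?s..1 - ?t} \<subseteq> {\<phi>. poly (?L - ?R) \<phi> = 0}"
  proof
    fix \<phi> assume "\<phi> \<in> {- 1 - ?s..1 - ?t}"
    then have "- 1 \<le> ?s + \<phi>" "?s + \<phi> \<le> 1" "- 1 \<le> ?t + \<phi>" "?t + \<phi> \<le> 1"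
      using pos diff by auto
    then obtain u v where uv: "cos u = ?t + \<phi>" "cos v = ?s + \<phi>"
      using cos_arccos by metis
    have "(?t - ?s) * poly ?L \<phi> = cos (n * u) - cos (n * v)"
      by (simp only: Qsubst_exact chebyshev_T_cos flip: uv)
    also have "\<dots> = (?t - ?s) * poly ?R \<phi>"
      using cos_multiple_diff_eq_prod_Ppoly[OF assms(1) uv(2,1)] uv
      by (simp add: poly_prod)
    finally have "poly ?L \<phi> = poly ?R \<phi>"
      using neq by (simp only: mult_cancel_left) simp
    then show "\<phi> \<in> {\<phi>. poly (?L - ?R) \<phi> = 0}" by simp
  qed
  with \<open>finite _\<close> have "finite {- 1 - ?s..1 - ?t}" by (rule finite_subset[rotated])
  moreover have "- 1 - ?s < 1 - ?t"
  proof -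
    \<comment> \<open>Strictness here makes \<open>?t - ?s < 2\<close>, so the interval has positive
      length and is infinite.\<close>
    have "sin \<alpha> < sin (pi / 2)"
      using \<alpha> by (intro sin_monotone_2pi) auto
    moreover have "sin \<alpha> * sin \<beta> \<le> sin \<alpha> * 1"
      using \<alpha> by (intro mult_left_mono sin_le_one sin_ge_zero) auto
    ultimately show ?thesis using diff by simp
  qed
  ultimately show False by (simp add: infinite_Icc)
qed

theorem mainTheorem3:
  fixes a b c :: nat
  assumes "a > 0" and "b > 0" and "c > 0" and "coprime a b" and "odd a"
  shows "Rpoly a b c =
    smult ((real c * 2 ^ (c - 1)) ^ ((a - 1) * (b - 1) div 2))
      (\<Prod>k = 1..c div 2. \<Prod>i = 1..(a - 1) div 2. \<Prod>j = 1..b - 1.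
         Ppoly (real i * pi / real a) (real j * pi / real b) (real k * pi / real c))"
proof -
  let ?\<alpha> = "\<lambda>i. real i * pi / real a" and ?\<beta> = "\<lambda>j. real j * pi / real b"
  let ?\<gamma> = "\<lambda>k. real k * pi / real c"
  let ?I = "{1..(a - 1) div 2}" and ?J = "{1..b - 1}" and ?K = "{1..c div 2}"
  let ?C = "real c * 2 ^ (c - 1)"
  have "Rpoly a b c = (\<Prod>i\<in>?I. \<Prod>j\<in>?J. smult ?C (\<Prod>k\<in>?K. Ppoly (?\<alpha> i) (?\<beta> j) (?\<gamma> k)))"
    unfolding Rpoly_def
  proof (intro prod.cong refl)
    fix i j assume "i \<in> ?I" "j \<in> ?J"
    \<comment> \<open>From \<open>2 * i \<le> a - 1\<close> the angle \<open>?\<alpha> i\<close>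
      stays strictly below \<open>pi / 2\<close>.\<close>
    then have "0 < i" "real i * 2 < real a" "0 < j" "real j < real b"
      by auto
    then have "0 < ?\<alpha> i" "?\<alpha> i < pi / 2" "0 < ?\<beta> j" "?\<beta> j < pi"
      by (simp_all add: field_simps)
    with assms(3) have "Qsubst c (cos (?\<beta> j + ?\<alpha> i)) (cos (?\<beta> j - ?\<alpha> i)) =
        smult ?C (\<Prod>k\<in>?K. Ppoly (?\<alpha> i) (?\<beta> j) (?\<gamma> k))"
      by (rule Qsubst_eq_prod_Ppoly)
    then show "Qsubst c (cos ((real j / real b + real i / real a) * pi))
        (cos ((real j / real b - real i / real a) * pi)) =
        smult ?C (\<Prod>k\<in>?K. Ppoly (?\<alpha> i) (?\<beta> j) (?\<gamma> k))"
      by (simp add: distrib_right left_diff_distrib)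
  qed
  also have "\<dots> = smult (?C ^ ((a - 1) div 2 * (b - 1)))
      (\<Prod>i\<in>?I. \<Prod>j\<in>?J. \<Prod>k\<in>?K. Ppoly (?\<alpha> i) (?\<beta> j) (?\<gamma> k))"
    by (simp add: prod_smult power_mult[symmetric] mult.commute)
  also have "(\<Prod>i\<in>?I. \<Prod>j\<in>?J. \<Prod>k\<in>?K. Ppoly (?\<alpha> i) (?\<beta> j) (?\<gamma> k)) =
      (\<Prod>i\<in>?I. \<Prod>k\<in>?K. \<Prod>j\<in>?J. Ppoly (?\<alpha> i) (?\<beta> j) (?\<gamma> k))"
    by (intro prod.cong refl prod.swap)
  also have "\<dots> = (\<Prod>k\<in>?K. \<Prod>i\<in>?I. \<Prod>j\<in>?J. Ppoly (?\<alpha> i) (?\<beta> j) (?\<gamma> k))"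
    by (rule prod.swap)
  \<comment> \<open>As \<open>a - 1\<close> is even, \<open>div\<close> is exact on both
    sides.\<close>
  also have "(a - 1) div 2 * (b - 1) = (a - 1) * (b - 1) div 2"
    using assms(5) by (auto elim!: oddE)
  finally show ?thesis .
qed

end
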